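(* Let $m\ge1$ and let $p$ be a probability distribution on $[m]=\{1,\dots,m\}$. Let $A(p)=\frac1m\sum_{j=1}^m p(j)$ and $G(p)=\bigl(\prod_{j=1}^m p(j)\bigr)^{1/m}$, and let $u$ be the uniform distribution on $[m]$. Then \[A(p)-G(p)\le \ln 2\cdot D(p\,\|\,u),\] where $D(p\,\|\,u)=\sum_{j=1}^m p(j)\log_2\frac{p(j)}{u(j)}$ (with $0\log 0=0$). *)

theory Defs
  imports "HOL-Probability.Probability"
begin

text \<open>A probability distribution on $[m]$ is a \<^typ>\<open>nat pmf\<close> with support contained in
  \<^term>\<open>{1..m::nat}\<close>.\<close>

definition arith_mean :: "nat \<Rightarrow> nat pmf \<Rightarrow> real" where
  "arith_mean m p = (1 / real m) * (\<Sum>j=1..m. pmf p j)"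

definition geom_mean :: "nat \<Rightarrow> nat pmf \<Rightarrow> real" where
  "geom_mean m p = (\<Prod>j=1..m. pmf p j) powr (1 / real m)"

definition uniform_dist :: "nat \<Rightarrow> nat pmf" where
  "uniform_dist m = pmf_of_set {1..m}"

text \<open>Relative entropy in bits. A summand with \<open>pmf p j = 0\<close> is \<open>0\<close>, which is the convention
  \<open>0 log 0 = 0\<close>. The value \<open>\<infinity>\<close> is not represented, so this is the usual relative entropy only
  if \<open>q\<close> is positive wherever \<open>p\<close> is; for \<open>q\<close> uniform this always holds.\<close>

definition rel_entropy :: "nat \<Rightarrow> nat pmf \<Rightarrow> nat pmf \<Rightarrow> real" where
  "rel_entropy m p q = (\<Sum>j=1..m. pmf p j * log 2 (pmf p j / pmf q j))"

end

theory Submission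
  imports Defs
begin

text \<open>Write \<open>g\<close> for the geometric mean and put \<open>q\<^sub>j = p\<^sub>j / ((m - 1) p\<^sub>j + g)\<close>. Then
  \<open>\<Sum>\<^sub>j q\<^sub>j \<le> 1\<close>, an inequality of symmetric AM-GM type, so Gibbs' inequality bounds the
  relative entropy from below by \<open>\<Sum>\<^sub>j p\<^sub>j ln (m q\<^sub>j)\<close>. Since \<open>ln t \<ge> 1 - 1/t\<close>, this is at
  least \<open>\<Sum>\<^sub>j (p\<^sub>j - g)/m = 1/m - g\<close>.\<close>

text \<open>For positive entries and \<open>n = card A - 1\<close>, pass to the complements
  \<open>1 - n * x i / (n * x i + g)\<close>, which equal \<open>g / (n * x i + g)\<close>. Each is
  at least a weight \<open>s i / S\<close>, and these weights add up to 1; summing over the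
  \<open>n + 1\<close> indices leaves at most \<open>n\<close> for \<open>n\<close> times the
  sum.\<close>

lemma sum_div_geometric_mean_le_1:
  fixes x :: "'a \<Rightarrow> real"
  assumes fin: "finite A" and nonneg: "\<And>i. i \<in> A \<Longrightarrow> x i \<ge> 0"
  defines "g \<equiv> (\<Prod>i\<in>A. x i) powr (1 / card A)"
  shows "(\<Sum>i\<in>A. x i / ((real (card A) - 1) * x i + g)) \<le> 1"
proof (cases "card A \<le> 1")
  case True
  then consider "A = {}" | a where "A = {a}"
    using fin by (metis One_nat_def card_1_singletonE card_eq_0_iff le_SucE le_zero_eq)
  then show ?thesis
    using nonneg by cases (auto simp: g_def)
next
  case False
  define n where "n = real (card A) - 1"
  have n: "n \<ge> 1" "real (card A) = n + 1"
    using False by (auto simp: n_def)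
  have "(\<Sum>i\<in>A. x i / (n * x i + g)) \<le> 1"
  proof (cases "\<exists>i\<in>A. x i = 0")
    case True
    then obtain k where k: "k \<in> A" "x k = 0" by blast
    have "g = 0" using True fin by (simp add: g_def prod_zero)
    \<comment> \<open>With \<open>g = 0\<close> each term is \<open>1 / n\<close>, or 0 where
      \<open>x i = 0\<close> since 0/0 = 0. Removing \<open>k\<close> leaves exactly
      \<open>n\<close> terms.\<close>
    then have "(\<Sum>i\<in>A. x i / (n * x i + g)) = (\<Sum>i\<in>A - {k}. x i / (n * x i))"
      using k fin by (simp add: sum.remove)
    also have "\<dots> \<le> (\<Sum>i\<in>A - {k}. 1 / n)"
      using n by (intro sum_mono) auto
    also have "\<dots> = 1"
      using n k fin by (simp add: of_nat_diff Suc_leI card_gt_0_iff)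
    finally show ?thesis .
  next
    case False
    then have pos: "x i > 0" if "i \<in> A" for i
      using nonneg that by (metis less_eq_real_def)
    have P: "(\<Prod>i\<in>A. x i) > 0" using pos by (simp add: prod_pos)
    then have g: "g > 0" by (simp add: g_def)
    \<comment> \<open>The exponent \<open>a = - n / (n + 1)\<close> solves
      \<open>1 + a = - a / n\<close>, so that
      \<open>x i * s i = (1 / s i) powr (1 / n)\<close>.\<close>
    define s where "s i = x i powr (- n / (n + 1))" for i
    have s: "s i > 0" if "i \<in> A" for i using pos[OF that] by (simp add: s_def)
    define S where "S = (\<Sum>i\<in>A. s i)"
    have "A \<noteq> {}" using \<open>\<not> card A \<le> 1\<close> by auto
    then have S: "S > 0" unfolding S_def using s fin by (intro sum_pos) auto
    have prod_s: "(\<Prod>i\<in>A. s i) = g powr (- n)"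
      unfolding s_def g_def n(2) by (simp add: prod_powr_distrib pos less_imp_le powr_powr)
    have key: "s i / S \<le> 1 - n * (x i / (n * x i + g))" if i: "i \<in> A" for i
    proof -
      let ?B = "A - {i}"
      have cB: "real (card ?B) = n"
        using i fin n \<open>\<not> card A \<le> 1\<close> by (simp add: of_nat_diff)
      have B: "finite ?B" "?B \<noteq> {}" using fin cB n by force+
      have pB: "(\<Prod>j\<in>?B. s j) = g powr (- n) / s i"
        using prod.remove[OF fin i, of s] prod_s s[OF i] by (simp add: field_simps)
      \<comment> \<open>By the choice of exponent, the left side is the geometric mean of the
        \<open>n\<close> values \<open>s j\<close> with j different from i. AM-GM then gives
        \<open>n * x i * s i \<le> g * (S - s i)\<close>, which is \<open>key\<close> with
        denominators cleared.\<close>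
      have "x i * s i / g = (g powr (- n) / s i) powr (1 / n)"
      proof -
        have "x i * s i = x i powr 1 * x i powr (- n / (n + 1))"
          using pos[OF i] by (simp add: s_def)
        also have "\<dots> = x i powr (1 / (n + 1))"
          unfolding powr_add[symmetric] using n by (simp add: field_simps)
        also have "\<dots> = (1 / s i) powr (1 / n)"
          using pos[OF i] n by (simp add: s_def powr_divide powr_powr powr_minus_divide)
        finally show ?thesis
          using g s[OF i] n by (simp add: powr_divide powr_mult powr_powr powr_minus_divide)
      qed
      also have "\<dots> \<le> (\<Sum>j\<in>?B. s j) / n"
        using arith_geom_mean[OF B, of s] s unfolding cB pB
        by (simp add: less_imp_le sum_divide_distrib)
      also have "(\<Sum>j\<in>?B. s j) = S - s i"
        using fin i by (simp add: S_def sum_diff1)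
      finally have "n * (x i * s i) \<le> g * (S - s i)"
        using g n by (simp add: field_simps)
      moreover have "n * x i + g > 0" using n g pos[OF i] by (simp add: add_pos_pos)
      ultimately show ?thesis using S by (simp add: field_simps)
    qed
    have "1 = (\<Sum>i\<in>A. s i / S)"
      using S by (simp add: S_def flip: sum_divide_distrib)
    also have "\<dots> \<le> (\<Sum>i\<in>A. 1 - n * (x i / (n * x i + g)))"
      by (intro sum_mono key)
    also have "\<dots> = (n + 1) - n * (\<Sum>i\<in>A. x i / (n * x i + g))"
      by (simp add: sum_subtractf n(2) sum_distrib_left)
    finally have "n * (\<Sum>i\<in>A. x i / (n * x i + g)) \<le> n * 1" by simp
    then show ?thesis using n by (simp add: mult_le_cancel_left)
  qed
  then show ?thesis by (simp add: n_def)
qed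

text \<open>With \<open>d = (m - 1) * x + g\<close> and q = x/d, split ln (m x) = ln (x/q) + ln (m
  q), where x/q = d, and apply ln t \<ge> 1 - 1/t to both parts. After multiplication by x, the
  first gives the Gibbs term x - q and the second gives x - d/m = (x - g)/m. The last assumption
  keeps \<open>d\<close> positive when \<open>x > 0\<close>.\<close>

lemma entropy_summand_ge:
  fixes x g m :: real
  assumes "x \<ge> 0" "g \<ge> 0" "m \<ge> 1" "m > 1 \<or> g > 0"
  shows "x - x / ((m - 1) * x + g) + (x - g) / m \<le> x * ln (m * x)"
proof (cases "x = 0")
  case False
  define d where "d = (m - 1) * x + g"
  have x: "x > 0" and d: "d > 0"
    using False assms by (auto simp: d_def add_pos_nonneg add_nonneg_pos)
  have "ln (1 / d) \<le> 1 / d - 1" "ln (d / (m * x)) \<le> d / (m * x) - 1"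
    using x d assms by (auto intro!: ln_le_minus_one)
  moreover have "ln (m * x) = - ln (1 / d) - ln (d / (m * x))"
    using x d assms by (simp add: ln_div)
  ultimately have "1 - 1 / d + (1 - d / (m * x)) \<le> ln (m * x)"
    by linarith
  then have "x * (1 - 1 / d + (1 - d / (m * x))) \<le> x * ln (m * x)"
    using x by (intro mult_left_mono) auto
  moreover have "x * (1 - 1 / d + (1 - d / (m * x))) = x - x / d + (x - g) / m"
    using x d assms by (simp add: d_def divide_simps) (simp add: algebra_simps)
  ultimately show ?thesis by (simp add: d_def)
qed (use assms in simp)

theorem theorem3p1:
  fixes m :: nat and p :: "nat pmf"
  assumes "m \<ge> 1"
    and "set_pmf p \<subseteq> {1..m}"
  shows "arith_mean m p - geom_mean m p \<le> ln 2 * rel_entropy m p (uniform_dist m)"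
proof -
  define g where "g = geom_mean m p"
  have g0: "g \<ge> 0" by (simp add: g_def geom_mean_def)
  have total: "(\<Sum>j=1..m. pmf p j) = 1"
    using assms by (intro sum_pmf_eq_1) auto
  \<comment> \<open>For \<open>m = 1\<close> all mass sits at 1, so \<open>g = 1\<close>.\<close>
  have nondeg: "real m > 1 \<or> g > 0"
  proof (cases "m = 1")
    case True
    then show ?thesis using total by (simp add: g_def geom_mean_def)
  qed (use assms in auto)
  have q_le: "(\<Sum>j=1..m. pmf p j / ((real m - 1) * pmf p j + g)) \<le> 1"
    using sum_div_geometric_mean_le_1[of "{1..m}" "pmf p"] by (simp add: g_def geom_mean_def)
  have "arith_mean m p - g = 1 / m - g"
    unfolding arith_mean_def total by simp
  \<comment> \<open>The added slack is the mass missing from the q's; it turns the bound into a sum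
    that can be compared term by term.\<close>
  also have "\<dots> \<le> 1 - (\<Sum>j=1..m. pmf p j / ((real m - 1) * pmf p j + g)) + (1 / m - g)"
    using q_le by simp
  also have "\<dots> = (\<Sum>j=1..m. pmf p j - pmf p j / ((real m - 1) * pmf p j + g) + (pmf p j - g) / m)"
    unfolding sum.distrib sum_subtractf sum_divide_distrib[symmetric] total
    using assms by (simp add: diff_divide_distrib)
  also have "\<dots> \<le> (\<Sum>j=1..m. pmf p j * ln (m * pmf p j))"
    using assms g0 nondeg by (intro sum_mono entropy_summand_ge) auto
  also have "\<dots> = ln 2 * rel_entropy m p (uniform_dist m)"
    \<comment> \<open>Dividing by the uniform mass 1/m multiplies by \<open>m\<close>, and the
      factor \<open>ln 2\<close> turns bits into nats.\<close>
    unfolding rel_entropy_def sum_distrib_left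
    using assms by (intro sum.cong) (auto simp: uniform_dist_def log_def mult.commute)
  finally show ?thesis by (simp add: g_def)
qed

end
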